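(* Let $(K,\partial)$ be a complex and let $(\mathtt g_i)_{i\le\beta_q}$ be a $q$-homology basis of $(K,\partial)$. Then $(\mathtt g_i)_{i\le\beta_q}$ is explicit if and only if it is induced by a $q$-tri-partition, i.e. if and only if there exist a $q$-tri-partition $(A^q,A_q,E_q)$ of $(K,\partial)$ and a bijection $i\mapsto\epsilon_i$ from $\{1,\dots,\beta_q\}$ to $E_q$ with $z_q(\epsilon_i)=\mathtt g_i$ for all $i$.
   Context: Coefficients are in $\mathcal F=\mathbb{Z}/2\mathbb{Z}$. A complex $(K,\partial)$ is the chain complex of a finite cellular complex of dimension $n$: for $0\le q\le n$, $K_q$ is the $\mathcal F$-vector space with basis the finite set $\overline{K_q}$ of $q$-cells, and $\partial_q:K_q\to K_{q-1}$ is the cellular boundary map, with $\partial_q\partial_{q+1}=0$ and $\partial_0=0$. Write $K=\bigoplus_q K_q$, $\partial=\bigoplus_q\partial_q$; $\partial^\ast$ is the transpose of $\partial$ in the basis of cells. $H_q(K)=\ker\partial_q/\operatorname{im}\partial_{q+1}$ and $\beta_q=\dim H_q(K)$. A $q$-homology basis of $(K,\partial)$ is a family $(\mathtt g_i)_{i\le\beta}$ of $q$-cycles (elements of $\ker\partial_q$) whose classes form a basis of $H_q(K)$. Explicit bases: for a chain $x$, $\overline x$ is the set of cells with nonzero coefficient in $x$. For a set of cells $A$, $(K(A),\partial)$ is the smallest sub-complex (spanned by cells) containing $A$; it is spanned by the cells of $A$ and all their faces. For a $q$-homology basis $(\mathtt g_i)_{i\le\beta}$, put $K^\beta=K\big(\bigcup_{i\le\beta}\overline{\mathtt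 g_i}\big)$. The basis is explicit if for all $k$, $\overline{\mathtt g_k}\setminus\bigcup_{i\ne k}\overline{\mathtt g_i}\neq\emptyset$, and $\dim H_q(K^\beta)=\beta$. Tri-partitions: a $q$-tree is a set $A$ of $q$-cells with $\operatorname{Span}A\cap\ker\partial=\{0\}$; a $q$-cotree is a set $A$ of $q$-cells with $\operatorname{Span}A\cap\ker\partial^\ast=\{0\}$. A $q$-tree (resp. $q$-cotree) is maximal if it is not strictly contained in another $q$-tree (resp. $q$-cotree). A $q$-tri-partition of $(K,\partial)$ is a triple $(A^q,A_q,E_q)$ forming a partition of the set of $q$-cells (parts may be empty) such that $A^q$ is a maximal $q$-cotree, $A_q$ is a maximal $q$-tree and $|E_q|=\beta_q$. For $\tau\in A^q\sqcup E_q$, there is a unique $q$-cycle in $\tau+\operatorname{Span}A_q$ (known fact), denoted $z_q(\tau)$. It is known that $(z_q(\epsilon))_{\epsilon\in E_q}$ is a $q$-homology basis; it is the basis induced by the tri-partition. *)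

theory Defs
  imports
    "HOL-Library.Z2"
    "HOL-Library.Function_Algebras"
    "HOL-Algebra.AbelCoset"
    "Jordan_Normal_Form.VS_Connect"
begin

text \<open>
  The field $\mathbb{Z}/2\mathbb{Z}$ is the type \<^typ>\<open>bit\<close>, turned into a carrier-based field by
  \<open>class_ring\<close>. A chain is a coefficient function on cells; a cell is identified with its
  indicator function \<open>cell_chain\<close>.
\<close>

type_synonym 'c chain = "'c \<Rightarrow> bit"

definition supp :: "'c chain \<Rightarrow> 'c set" where
  "supp x = {c. x c \<noteq> 0}"

definition cell_chain :: "'c \<Rightarrow> 'c chain" where
  "cell_chain \<tau> = (\<lambda>c. if c = \<tau> then 1 else 0)"

text \<open>For a finite set \<open>A\<close> of cells, \<open>chains A\<close> is the vector space with basis \<open>A\<close>, i.e. Span \<open>A\<close>.\<close>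

definition chains :: "'c set \<Rightarrow> 'c chain set" where
  "chains A = {x. supp x \<subseteq> A}"

text \<open>
  The cells of a complex are given degree by degree; \<open>incidence K \<tau> \<sigma>\<close> is the coefficient of
  \<open>\<sigma>\<close> in the boundary of \<open>\<tau>\<close>. Incidence numbers involving elements that are not cells of \<open>K\<close>
  are ignored.
\<close>

record 'c cell_complex =
  cells :: "nat \<Rightarrow> 'c set"
  incidence :: "'c \<Rightarrow> 'c \<Rightarrow> bit"

definition all_cells :: "'c cell_complex \<Rightarrow> 'c set" where
  "all_cells K = (\<Union>q. cells K q)"

definition bdry :: "'c cell_complex \<Rightarrow> 'c chain \<Rightarrow> 'c chain" where
  "bdry K x = (\<lambda>\<sigma>. if \<sigma> \<in> all_cells K then \<Sum>\<tau>\<in>all_cells K. incidence K \<tau> \<sigma> * x \<tau> else 0)"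

definition cobdry :: "'c cell_complex \<Rightarrow> 'c chain \<Rightarrow> 'c chain" where
  "cobdry K x = (\<lambda>\<tau>. if \<tau> \<in> all_cells K then \<Sum>\<sigma>\<in>all_cells K. incidence K \<tau> \<sigma> * x \<sigma> else 0)"

text \<open>
  Only the chain complex of a cellular complex, with its basis of cells, is recorded; no attaching
  maps and no realisability condition. The set of \<open>n\<close>-cells may be empty, i.e. the dimension is at
  most \<open>n\<close>.
\<close>

definition cell_complex :: "nat \<Rightarrow> 'c cell_complex \<Rightarrow> bool" where
  "cell_complex n K \<longleftrightarrow>
     (\<forall>q. finite (cells K q)) \<and>
     (\<forall>q>n. cells K q = {}) \<and>
     (\<forall>p q. p \<noteq> q \<longrightarrow> cells K p \<inter> cells K q = {}) \<and>
     (\<forall>x\<in>chains (cells K 0). bdry K x = 0) \<and>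
     (\<forall>q. \<forall>x\<in>chains (cells K (Suc q)). bdry K x \<in> chains (cells K q)) \<and>
     (\<forall>x\<in>chains (all_cells K). bdry K (bdry K x) = 0)"

definition ker_bdry :: "'c cell_complex \<Rightarrow> 'c chain set" where
  "ker_bdry K = {x \<in> chains (all_cells K). bdry K x = 0}"

definition ker_cobdry :: "'c cell_complex \<Rightarrow> 'c chain set" where
  "ker_cobdry K = {x \<in> chains (all_cells K). cobdry K x = 0}"

definition cycles :: "'c cell_complex \<Rightarrow> nat \<Rightarrow> 'c chain set" where
  "cycles K q = {x \<in> chains (cells K q). bdry K x = 0}"

definition boundaries :: "'c cell_complex \<Rightarrow> nat \<Rightarrow> 'c chain set" where
  "boundaries K q = bdry K ` chains (cells K (Suc q))"

text \<open>
  Quotient of a vector space by a subspace: the scalar multiple of a coset is the union of the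
  cosets of the scalar multiples of its members (all equal). The fields \<open>mult\<close> and \<open>one\<close>, which
  the record type inherits from rings, play no role in modules.
\<close>

definition quotient_space :: "('k, 'v, 'm) module_scheme \<Rightarrow> 'v set \<Rightarrow> ('k, 'v set) module" where
  "quotient_space V W =
     \<lparr>carrier = a_rcosets\<^bsub>V\<^esub> W, mult = (\<lambda>X Y. W), one = W,
      zero = W, add = (\<lambda>X Y. X <+>\<^bsub>V\<^esub> Y),
      smult = (\<lambda>a X. \<Union>x\<in>X. W +>\<^bsub>V\<^esub> (a \<odot>\<^bsub>V\<^esub> x))\<rparr>"

definition chain_space :: "'c chain set \<Rightarrow> (bit, 'c chain) module" where
  "chain_space Z =
     \<lparr>carrier = Z, mult = (\<lambda>x y. 0), one = 0, zero = 0, add = (+),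
      smult = (\<lambda>a x c. a * x c)\<rparr>"

definition homology :: "'c cell_complex \<Rightarrow> nat \<Rightarrow> (bit, 'c chain set) module" where
  "homology K q = quotient_space (chain_space (cycles K q)) (boundaries K q)"

definition homology_class :: "'c cell_complex \<Rightarrow> nat \<Rightarrow> 'c chain \<Rightarrow> 'c chain set" where
  "homology_class K q z = boundaries K q +>\<^bsub>chain_space (cycles K q)\<^esub> z"

definition betti :: "'c cell_complex \<Rightarrow> nat \<Rightarrow> nat" where
  "betti K q = vectorspace.dim class_ring (homology K q)"

text \<open>
  Families are indexed by \<open>{1..\<beta>}\<close>. Since \<open>vectorspace.basis\<close> speaks about sets of vectors,
  the injectivity condition is what makes the family of classes, and not just its range, a basis.
\<close>

definition homology_basis :: "'c cell_complex \<Rightarrow> nat \<Rightarrow> nat \<Rightarrow> (nat \<Rightarrow> 'c chain) \<Rightarrow> bool" where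
  "homology_basis K q \<beta> g \<longleftrightarrow>
     (\<forall>i\<in>{1..\<beta>}. g i \<in> cycles K q) \<and>
     inj_on (\<lambda>i. homology_class K q (g i)) {1..\<beta>} \<and>
     vectorspace.basis class_ring (homology K q) ((\<lambda>i. homology_class K q (g i)) ` {1..\<beta>})"

definition spans_subcomplex :: "'c cell_complex \<Rightarrow> 'c set \<Rightarrow> bool" where
  "spans_subcomplex K B \<longleftrightarrow> B \<subseteq> all_cells K \<and> bdry K ` chains B \<subseteq> chains B"

definition generated_subcomplex :: "'c cell_complex \<Rightarrow> 'c set \<Rightarrow> 'c cell_complex" where
  "generated_subcomplex K A =
     K\<lparr>cells := (\<lambda>q. cells K q \<inter> \<Inter>{B. spans_subcomplex K B \<and> A \<subseteq> B})\<rparr>"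

definition explicit_basis :: "'c cell_complex \<Rightarrow> nat \<Rightarrow> nat \<Rightarrow> (nat \<Rightarrow> 'c chain) \<Rightarrow> bool" where
  "explicit_basis K q \<beta> g \<longleftrightarrow>
     (\<forall>k\<in>{1..\<beta>}. supp (g k) - (\<Union>i\<in>{1..\<beta>} - {k}. supp (g i)) \<noteq> {}) \<and>
     betti (generated_subcomplex K (\<Union>i\<in>{1..\<beta>}. supp (g i))) q = \<beta>"

definition q_tree :: "'c cell_complex \<Rightarrow> nat \<Rightarrow> 'c set \<Rightarrow> bool" where
  "q_tree K q A \<longleftrightarrow> A \<subseteq> cells K q \<and> chains A \<inter> ker_bdry K = {0}"

definition q_cotree :: "'c cell_complex \<Rightarrow> nat \<Rightarrow> 'c set \<Rightarrow> bool" where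
  "q_cotree K q A \<longleftrightarrow> A \<subseteq> cells K q \<and> chains A \<inter> ker_cobdry K = {0}"

definition maximal_q_tree :: "'c cell_complex \<Rightarrow> nat \<Rightarrow> 'c set \<Rightarrow> bool" where
  "maximal_q_tree K q A \<longleftrightarrow> q_tree K q A \<and> \<not> (\<exists>B. q_tree K q B \<and> A \<subset> B)"

definition maximal_q_cotree :: "'c cell_complex \<Rightarrow> nat \<Rightarrow> 'c set \<Rightarrow> bool" where
  "maximal_q_cotree K q A \<longleftrightarrow> q_cotree K q A \<and> \<not> (\<exists>B. q_cotree K q B \<and> A \<subset> B)"

definition tri_partition ::
  "'c cell_complex \<Rightarrow> nat \<Rightarrow> 'c set \<Rightarrow> 'c set \<Rightarrow> 'c set \<Rightarrow> bool" where
  "tri_partition K q C T E \<longleftrightarrow>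
     C \<union> T \<union> E = cells K q \<and> C \<inter> T = {} \<and> C \<inter> E = {} \<and> T \<inter> E = {} \<and>
     maximal_q_cotree K q C \<and> maximal_q_tree K q T \<and> card E = betti K q"

text \<open>
  The unique \<open>q\<close>-cycle in \<open>\<tau> +\<close> Span \<open>T\<close>; existence and uniqueness hold when \<open>T\<close> is a maximal
  \<open>q\<close>-tree and \<open>\<tau>\<close> is a \<open>q\<close>-cell outside \<open>T\<close>.
\<close>

definition induced_cycle :: "'c cell_complex \<Rightarrow> nat \<Rightarrow> 'c set \<Rightarrow> 'c \<Rightarrow> 'c chain" where
  "induced_cycle K q T \<tau> = (THE z. z \<in> cycles K q \<and> (\<exists>a\<in>chains T. z = cell_chain \<tau> + a))"

end

theory Submission
  imports Defs
begin

text \<open>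
  Let \<open>A\<close> be the set of all cells occurring in the \<open>g i\<close>. The subcomplex generated by \<open>A\<close> has no
  \<open>(q + 1)\<close>-cells, so its Betti number is the dimension of the space of cycles supported in \<open>A\<close>, and
  explicitness means: each \<open>g i\<close> has a private cell \<open>\<epsilon> i\<close>, and every cycle supported in \<open>A\<close> is a
  combination of the \<open>g i\<close>.

  If this holds, \<open>A\<close> without the private cells is a tree, because a cycle in it has all coefficients
  zero. Extend it to a maximal tree \<open>T\<close>; it avoids the private cells, and \<open>g i\<close> is the cycle that \<open>\<epsilon> i\<close>
  closes over \<open>T\<close>. For the remaining set of cells \<open>C\<close>, restriction of boundaries to \<open>C\<close> is injective (a
  boundary vanishing on \<open>C\<close> is a combination of the \<open>g i\<close>, hence zero) and surjective (correct the
  cycle closed by \<open>\<tau> \<in> C\<close> over \<open>T\<close> by a combination of the \<open>g i\<close>, which vanish on \<open>C\<close>). As cocycles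
  are the orthogonal complement of the boundaries, \<open>C\<close> is a maximal cotree.

  Conversely, if \<open>g i\<close> is the cycle closed by \<open>\<epsilon> i\<close> over \<open>T\<close>, then \<open>\<epsilon> i\<close> is private to it, and a cycle
  supported in \<open>A\<close> minus its evident combination of the \<open>g i\<close> is supported in \<open>T\<close>, hence zero.
\<close>

text \<open>
  The default simp rules rewrite \<open>+\<close> and \<open>*\<close> on \<open>bit\<close> to bit operations, out of reach of the
  group and sum lemmas.
\<close>

declare add_bit_eq_xor [simp del] mult_bit_eq_and [simp del]

section \<open>Chains over the field with two elements\<close>

lemma bit_add_self [simp]: "(a::bit) + a = 0"
  by (cases a) (simp_all flip: one_add_one)

lemma bit_add_eq_0_iff: "(a::bit) + b = 0 \<longleftrightarrow> a = b"
  by (cases a; cases b) simp_all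

lemma chain_add_self [simp]: "(x::'c chain) + x = 0"
  by (simp add: fun_eq_iff)

lemma chain_add_self_left [simp]: "(x::'c chain) + (x + y) = y"
  by (simp flip: add.assoc)

lemma chain_add_eq_0_iff: "(x::'c chain) + y = 0 \<longleftrightarrow> x = y"
  by (simp add: fun_eq_iff bit_add_eq_0_iff)

text \<open>The scalar multiplication of \<open>chain_space\<close>, available without reference to
  a carrier.\<close>

definition chain_scale :: "bit \<Rightarrow> 'c chain \<Rightarrow> 'c chain" where
  "chain_scale a x = (\<lambda>c. a * x c)"

lemma chain_scale_simps [simp]: "chain_scale 0 x = 0" "chain_scale 1 x = x"
  by (simp_all add: chain_scale_def fun_eq_iff)

text \<open>Combinations run over an index set, so equal members count separately.
  \<open>lincomb\<close> runs over sets of vectors, where they would collapse.\<close>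

definition chain_comb :: "('i \<Rightarrow> bit) \<Rightarrow> ('i \<Rightarrow> 'c chain) \<Rightarrow> 'i set \<Rightarrow> 'c chain" where
  "chain_comb a g I = (\<lambda>c. \<Sum>i\<in>I. a i * g i c)"

lemma chain_comb_empty [simp]: "chain_comb a g {} = 0"
  by (simp add: chain_comb_def fun_eq_iff)

lemma chain_comb_insert [simp]:
  "finite I \<Longrightarrow> i \<notin> I \<Longrightarrow> chain_comb a g (insert i I) = chain_scale (a i) (g i) + chain_comb a g I"
  by (simp add: chain_comb_def chain_scale_def fun_eq_iff)

lemma chain_comb_zero: "(\<And>i. i \<in> I \<Longrightarrow> a i = 0) \<Longrightarrow> chain_comb a g I = 0"
  by (simp add: chain_comb_def fun_eq_iff)

text \<open>\<open>lincomb\<close> takes its coefficients on vectors, \<open>chain_comb\<close> on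
  indices; injectivity makes the passage from indices to vectors well defined.\<close>

lemma ex_coefficients:
  assumes "inj_on h I"
  shows "\<exists>a'. \<forall>i\<in>I. a' (h i) = (a i :: bit)"
  by (rule exI[of _ "\<lambda>x. a (inv_into I h x)"]) (use assms in auto)

lemma chain_comb_cong: "(\<And>i. i \<in> I \<Longrightarrow> a i = a' i) \<Longrightarrow> chain_comb a g I = chain_comb a' g I"
  by (simp add: chain_comb_def)

text \<open>Evaluation at a cell contained in only one member reads off a coefficient. It serves
  both for the private cells and for the boundaries dual to the cells of a cotree.\<close>

lemma chain_comb_apply_delta:
  assumes "finite I" "j \<in> I" "\<And>i. i \<in> I \<Longrightarrow> g i c = (if i = j then 1 else 0)"
  shows "chain_comb a g I c = a j"
proof -
  have "a i * g i c = (if i = j then a i else 0)" if "i \<in> I" for i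
    using assms(3)[OF that] by simp
  then have "chain_comb a g I c = (\<Sum>i\<in>I. if i = j then a i else 0)"
    unfolding chain_comb_def by (rule sum.cong[OF refl])
  then show ?thesis using assms(1,2) by simp
qed

text \<open>Closure under scalars is automatic, the only scalars being 0 and 1.\<close>

definition chain_subspace :: "'c chain set \<Rightarrow> bool" where
  "chain_subspace W \<longleftrightarrow> 0 \<in> W \<and> (\<forall>x\<in>W. \<forall>y\<in>W. x + y \<in> W)"

lemma chain_subspace_scale: "chain_subspace W \<Longrightarrow> x \<in> W \<Longrightarrow> chain_scale a x \<in> W"
  by (cases a) (simp_all add: chain_subspace_def)

lemma chain_subspace_comb:
  assumes "chain_subspace W" "finite I" "\<And>i. i \<in> I \<Longrightarrow> g i \<in> W"
  shows "chain_comb a g I \<in> W"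
  using assms(2,3)
proof (induction I rule: finite_induct)
  case empty
  show ?case using assms(1) by (simp add: chain_subspace_def del: zero_fun_apply)
next
  case (insert i I)
  then have "chain_scale (a i) (g i) \<in> W" "chain_comb a g I \<in> W"
    by (auto intro: chain_subspace_scale[OF assms(1)])
  with insert.hyps assms(1) show ?case by (simp add: chain_subspace_def del: plus_fun_apply)
qed

section \<open>Quotients of spaces of chains\<close>

text \<open>Later \<open>Z\<close> consists of cycles and \<open>B\<close> of boundaries, both for
  \<open>K\<close> and for a generated subcomplex.\<close>

locale chain_pair =
  fixes Z B :: "'c chain set"
  assumes B_subset: "B \<subseteq> Z" and subspace_Z: "chain_subspace Z" and subspace_B: "chain_subspace B"
begin

abbreviation "H \<equiv> quotient_space (chain_space Z) B"

definition coset :: "'c chain \<Rightarrow> 'c chain set" where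
  "coset z = B +>\<^bsub>chain_space Z\<^esub> z"

lemma coset_eq: "coset z = (\<lambda>b. b + z) ` B"
  by (auto simp: coset_def a_r_coset_def' chain_space_def)

lemma add_B: "x \<in> B \<Longrightarrow> y \<in> B \<Longrightarrow> x + y \<in> B"
  using subspace_B by (simp add: chain_subspace_def)

lemma zero_B: "0 \<in> B"
  using subspace_B by (simp add: chain_subspace_def)

lemma add_Z: "x \<in> Z \<Longrightarrow> y \<in> Z \<Longrightarrow> x + y \<in> Z"
  using subspace_Z by (simp add: chain_subspace_def)

lemma zero_Z: "0 \<in> Z"
  using subspace_Z by (simp add: chain_subspace_def)

text \<open>In characteristic 2 the difference of \<open>x\<close> and \<open>z\<close> is their
  sum.\<close>

lemma mem_coset: "x \<in> coset z \<longleftrightarrow> x + z \<in> B"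
proof -
  have "x = (x + z) + z" by (simp add: add.assoc)
  then show ?thesis
    unfolding coset_eq by (auto simp: add.assoc intro: image_eqI[of _ _ "x + z"])
qed

lemma coset_eq_iff: "coset z = coset w \<longleftrightarrow> z + w \<in> B"
proof
  assume "coset z = coset w"
  moreover have "z \<in> coset z" by (simp add: mem_coset zero_B)
  ultimately show "z + w \<in> B" by (simp add: mem_coset)
next
  assume zw: "z + w \<in> B"
  have "x + z \<in> B \<longleftrightarrow> x + w \<in> B" for x
    using add_B[OF zw, of "x + z"] add_B[OF zw, of "x + w"]
    by (auto simp: ac_simps)
  then show "coset z = coset w" by (auto simp: mem_coset)
qed

lemma carrier_H: "carrier H = coset ` Z"
  by (auto simp: quotient_space_def A_RCOSETS_def' coset_def chain_space_def)

lemma zero_H: "\<zero>\<^bsub>H\<^esub> = coset 0"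
  by (simp add: quotient_space_def coset_eq)

lemma add_H: "coset z \<oplus>\<^bsub>H\<^esub> coset w = coset (z + w)"
proof -
  have "coset z \<oplus>\<^bsub>H\<^esub> coset w = {x + y | x y. x \<in> coset z \<and> y \<in> coset w}"
    by (auto simp: quotient_space_def set_add_def' chain_space_def)
  also have "\<dots> = coset (z + w)"
  proof (intro equalityI subsetI)
    fix u assume "u \<in> {x + y | x y. x \<in> coset z \<and> y \<in> coset w}"
    then obtain x y where "u = x + y" "x + z \<in> B" "y + w \<in> B"
      by (auto simp: mem_coset)
    then show "u \<in> coset (z + w)"
      using add_B[of "x + z" "y + w"] by (simp add: mem_coset ac_simps)
  next
    fix u assume "u \<in> coset (z + w)"
    then have "u + w \<in> coset z" "w \<in> coset w" "u = (u + w) + w"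
      by (auto simp: mem_coset ac_simps zero_B)
    then show "u \<in> {x + y | x y. x \<in> coset z \<and> y \<in> coset w}" by blast
  qed
  finally show ?thesis .
qed

lemma smult_H: "a \<odot>\<^bsub>H\<^esub> coset z = coset (chain_scale a z)"
proof -
  have "a \<odot>\<^bsub>H\<^esub> coset z = (\<Union>x\<in>coset z. coset (chain_scale a x))"
    by (simp add: quotient_space_def coset_def chain_space_def chain_scale_def)
  also have "\<dots> = coset (chain_scale a z)"
  proof -
    \<comment> \<open>Members of one coset differ by an element of \<open>B\<close>, and so do their
      multiples: the union over \<open>x\<close> is a single coset.\<close>
    have "coset (chain_scale a x) = coset (chain_scale a z)" if "x \<in> coset z" for x
      using that by (cases a) (simp_all add: coset_eq_iff mem_coset zero_B)
    moreover have "z \<in> coset z" by (simp add: mem_coset zero_B)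
    ultimately show ?thesis by blast
  qed
  finally show ?thesis .
qed

lemma abelian_group_H: "abelian_group H"
proof (rule abelian_groupI)
  fix x assume "x \<in> carrier H"
  then obtain z where z: "z \<in> Z" "x = coset z" by (auto simp: carrier_H)
  \<comment> \<open>Every class is its own inverse.\<close>
  then show "\<exists>y\<in>carrier H. y \<oplus>\<^bsub>H\<^esub> x = \<zero>\<^bsub>H\<^esub>"
    by (intro bexI[of _ x]) (auto simp: carrier_H add_H zero_H)
qed (auto simp: carrier_H add_H zero_H ac_simps intro: add_Z zero_Z)

lemma vectorspace_H: "vectorspace class_ring H"
proof -
  have "module class_ring H"
  proof (rule moduleI)
    show "cring (class_ring :: bit ring)" by (rule class_cring.cring_axioms)
  next
    fix a b :: bit and x
    assume "x \<in> carrier H"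
    then show "(a \<oplus>\<^bsub>class_ring\<^esub> b) \<odot>\<^bsub>H\<^esub> x = a \<odot>\<^bsub>H\<^esub> x \<oplus>\<^bsub>H\<^esub> b \<odot>\<^bsub>H\<^esub> x"
      by (cases a; cases b) (auto simp: carrier_H smult_H add_H)
  next
    fix a b :: bit and x
    assume "x \<in> carrier H"
    then show "(a \<otimes>\<^bsub>class_ring\<^esub> b) \<odot>\<^bsub>H\<^esub> x = a \<odot>\<^bsub>H\<^esub> (b \<odot>\<^bsub>H\<^esub> x)"
      by (cases a) (auto simp: carrier_H smult_H)
  next
    fix a :: bit and x y
    assume "x \<in> carrier H" "y \<in> carrier H"
    then show "a \<odot>\<^bsub>H\<^esub> (x \<oplus>\<^bsub>H\<^esub> y) = a \<odot>\<^bsub>H\<^esub> x \<oplus>\<^bsub>H\<^esub> a \<odot>\<^bsub>H\<^esub> y"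
      by (cases a) (auto simp: carrier_H smult_H add_H)
  qed (auto simp: carrier_H smult_H abelian_group_H chain_subspace_scale[OF subspace_Z])
  then show ?thesis
    by (intro vectorspace.intro class_field.field_axioms)
qed

sublocale quotient: vectorspace class_ring H
  by (rule vectorspace_H)

lemma finsum_coset:
  assumes "finite I" "\<And>i. i \<in> I \<Longrightarrow> g i \<in> Z"
  shows "finsum H (\<lambda>i. coset (chain_scale (a i) (g i))) I = coset (chain_comb a g I)"
  using assms
proof (induction I rule: finite_induct)
  case empty
  show ?case by (simp add: zero_H del: zero_fun_apply)
next
  case (insert i I)
  then show ?case
    by (subst quotient.finsum_insert)
      (auto simp: carrier_H add_H intro!: imageI chain_subspace_scale[OF subspace_Z])
qed

text \<open>Injectivity turns the sum over a set of cosets into a sum over indices; the projection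
  to the quotient is linear.\<close>

lemma lincomb_coset:
  assumes "finite I" "\<And>i. i \<in> I \<Longrightarrow> g i \<in> Z" "inj_on (\<lambda>i. coset (g i)) I"
  shows "quotient.lincomb a ((\<lambda>i. coset (g i)) ` I) = coset (chain_comb (\<lambda>i. a (coset (g i))) g I)"
proof -
  have "quotient.lincomb a ((\<lambda>i. coset (g i)) ` I)
      = finsum H (\<lambda>i. a (coset (g i)) \<odot>\<^bsub>H\<^esub> coset (g i)) I"
    unfolding quotient.lincomb_def using assms
    by (subst quotient.finsum_reindex)
      (auto simp: carrier_H smult_H intro!: imageI chain_subspace_scale[OF subspace_Z])
  also have "\<dots> = coset (chain_comb (\<lambda>i. a (coset (g i))) g I)"
    using finsum_coset[OF assms(1,2)] by (simp add: smult_H)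
  finally show ?thesis .
qed

lemma lin_indpt_coset_iff:
  fixes g :: "'i \<Rightarrow> 'c chain"
  assumes I: "finite I" "\<And>i. i \<in> I \<Longrightarrow> g i \<in> Z" "inj_on (\<lambda>i. coset (g i)) I"
  shows "quotient.lin_indpt ((\<lambda>i. coset (g i)) ` I)
    \<longleftrightarrow> (\<forall>a. chain_comb a g I \<in> B \<longrightarrow> (\<forall>i\<in>I. a i = 0))" (is "?L \<longleftrightarrow> ?R")
proof
  assume L: ?L
  show ?R
  proof (intro allI impI)
    fix a assume a: "chain_comb a g I \<in> B"
    obtain a' where a': "\<And>i. i \<in> I \<Longrightarrow> a' (coset (g i)) = a i"
      using ex_coefficients[OF I(3), of a] by blast
    have "quotient.lincomb a' ((\<lambda>i. coset (g i)) ` I) = \<zero>\<^bsub>H\<^esub>"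
      using a by (simp add: lincomb_coset[OF I] zero_H coset_eq_iff a' cong: chain_comb_cong)
    then have "\<not> (\<exists>v\<in>(\<lambda>i. coset (g i)) ` I. a' v \<noteq> 0)"
      using L I(1) unfolding quotient.lin_dep_def by fastforce
    with a' show "\<forall>i\<in>I. a i = 0" by auto
  qed
next
  assume R: ?R
  show ?L
  proof (rule quotient.finite_lin_indpt2)
    fix a assume "quotient.lincomb a ((\<lambda>i. coset (g i)) ` I) = \<zero>\<^bsub>H\<^esub>"
    then have "chain_comb (\<lambda>i. a (coset (g i))) g I \<in> B"
      by (simp add: lincomb_coset[OF I] zero_H coset_eq_iff)
    with R show "\<forall>v\<in>(\<lambda>i. coset (g i)) ` I. a v = \<zero>\<^bsub>class_ring\<^esub>"
      by auto
  qed (use I in \<open>auto simp: carrier_H\<close>)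
qed

lemma gen_set_coset_iff:
  fixes g :: "'i \<Rightarrow> 'c chain"
  assumes I: "finite I" "\<And>i. i \<in> I \<Longrightarrow> g i \<in> Z" "inj_on (\<lambda>i. coset (g i)) I"
  shows "quotient.gen_set ((\<lambda>i. coset (g i)) ` I)
    \<longleftrightarrow> (\<forall>z\<in>Z. \<exists>a. z + chain_comb a g I \<in> B)" (is "?L \<longleftrightarrow> ?R")
proof -
  have "quotient.span ((\<lambda>i. coset (g i)) ` I)
      = {quotient.lincomb a ((\<lambda>i. coset (g i)) ` I) |a. a \<in> ((\<lambda>i. coset (g i)) ` I) \<rightarrow> carrier class_ring}"
    by (rule quotient.finite_span) (use I in \<open>auto simp: carrier_H\<close>)
  also have "\<dots> = {coset (chain_comb a g I) |a. True}"
  proof (intro equalityI subsetI; clarify)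
    fix a :: "'i \<Rightarrow> bit"
    obtain a' where a': "\<And>i. i \<in> I \<Longrightarrow> a' (coset (g i)) = a i"
      using ex_coefficients[OF I(3), of a] by blast
    then show "\<exists>a'. coset (chain_comb a g I) = quotient.lincomb a' ((\<lambda>i. coset (g i)) ` I)
        \<and> a' \<in> ((\<lambda>i. coset (g i)) ` I) \<rightarrow> carrier class_ring"
      by (intro exI[of _ a']) (simp add: lincomb_coset[OF I] a' cong: chain_comb_cong)
  qed (auto simp: lincomb_coset[OF I])
  finally have span: "quotient.span ((\<lambda>i. coset (g i)) ` I) = {coset (chain_comb a g I) |a. True}" .
  have "{coset (chain_comb a g I) |a. True} \<subseteq> carrier H"
    using I by (auto simp: carrier_H intro!: imageI chain_subspace_comb[OF subspace_Z])
  then have "?L \<longleftrightarrow> carrier H \<subseteq> {coset (chain_comb a g I) |a. True}"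
    unfolding span by blast
  also have "\<dots> \<longleftrightarrow> (\<forall>z\<in>Z. \<exists>a. coset z = coset (chain_comb a g I))"
    unfolding carrier_H by blast
  finally show ?thesis by (simp add: coset_eq_iff)
qed

text \<open>The carrier is finite, so it is itself a finite generating set.\<close>

lemma fin_dim_H: "finite Z \<Longrightarrow> quotient.fin_dim"
  unfolding quotient.fin_dim_def
  by (intro exI[of _ "carrier H"] conjI equalityI subset_refl
      quotient.in_own_span[OF subset_refl] quotient.span_is_subset2[OF subset_refl])
    (simp add: carrier_H)

lemma inj_on_coset:
  fixes g :: "'i \<Rightarrow> 'c chain"
  assumes I: "finite I" and ind: "\<And>a. chain_comb a g I \<in> B \<Longrightarrow> \<forall>i\<in>I. a i = 0"
  shows "inj_on (\<lambda>i. coset (g i)) I"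
proof (rule inj_onI, rule ccontr)
  fix i j assume ij: "i \<in> I" "j \<in> I" "coset (g i) = coset (g j)" "i \<noteq> j"
  \<comment> \<open>Two equal cosets would give a combination in \<open>B\<close> with coefficients
    1 at \<open>i\<close> and \<open>j\<close>, against \<open>ind\<close>.\<close>
  define a :: "'i \<Rightarrow> bit" where "a = (\<lambda>k. if k = i \<or> k = j then 1 else 0)"
  have eq: "I = insert i (insert j (I - {i, j}))" using ij by blast
  have "chain_comb a g (insert i (insert j (I - {i, j}))) = g i + (g j + chain_comb a g (I - {i, j}))"
    using I ij(4) by (simp add: a_def)
  moreover have "chain_comb a g (I - {i, j}) = 0"
    by (rule chain_comb_zero) (simp add: a_def)
  ultimately have "chain_comb a g I = g i + g j"
    using eq by simp
  then have "a i = 0" using ij ind[of a] by (simp add: coset_eq_iff)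
  then show False by (simp add: a_def)
qed

text \<open>Independence modulo \<open>B\<close> already forces the classes to be distinct, so
  injectivity disappears on the right, where only chains occur.\<close>

lemma basis_coset_iff:
  fixes g :: "'i \<Rightarrow> 'c chain"
  assumes I: "finite I" "\<And>i. i \<in> I \<Longrightarrow> g i \<in> Z"
  shows "inj_on (\<lambda>i. coset (g i)) I \<and> quotient.basis ((\<lambda>i. coset (g i)) ` I) \<longleftrightarrow>
    (\<forall>a. chain_comb a g I \<in> B \<longrightarrow> (\<forall>i\<in>I. a i = 0)) \<and> (\<forall>z\<in>Z. \<exists>a. z + chain_comb a g I \<in> B)"
proof -
  have sub: "(\<lambda>i. coset (g i)) ` I \<subseteq> carrier H" using I by (auto simp: carrier_H)
  have "quotient.basis ((\<lambda>i. coset (g i)) ` I) \<longleftrightarrow>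
    (\<forall>a. chain_comb a g I \<in> B \<longrightarrow> (\<forall>i\<in>I. a i = 0)) \<and> (\<forall>z\<in>Z. \<exists>a. z + chain_comb a g I \<in> B)"
    if "inj_on (\<lambda>i. coset (g i)) I"
    by (simp only: quotient.basis_def lin_indpt_coset_iff[OF I that] gen_set_coset_iff[OF I that]
        sub simp_thms)
  moreover have "inj_on (\<lambda>i. coset (g i)) I"
    if "\<forall>a. chain_comb a g I \<in> B \<longrightarrow> (\<forall>i\<in>I. a i = 0)"
    using I(1) by (rule inj_on_coset) (use that in simp)
  ultimately show ?thesis by argo
qed

text \<open>An independent family as large as the dimension is a basis. This turns the Betti number
  condition of explicitness into a basis condition.\<close>

lemma basis_coset_of_dim:
  fixes g :: "'i \<Rightarrow> 'c chain"
  assumes I: "finite I" "\<And>i. i \<in> I \<Longrightarrow> g i \<in> Z" and fin: "finite Z"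
    and ind: "\<And>a. chain_comb a g I \<in> B \<Longrightarrow> \<forall>i\<in>I. a i = 0"
    and dim: "quotient.dim = card I"
  shows "inj_on (\<lambda>i. coset (g i)) I \<and> quotient.basis ((\<lambda>i. coset (g i)) ` I)"
proof -
  have inj: "inj_on (\<lambda>i. coset (g i)) I" using I(1) ind by (rule inj_on_coset)
  moreover have "quotient.basis ((\<lambda>i. coset (g i)) ` I)"
  proof (rule quotient.dim_li_is_basis)
    show "quotient.lin_indpt ((\<lambda>i. coset (g i)) ` I)"
      by (rule lin_indpt_coset_iff[OF I inj, THEN iffD2]) (assumption | intro allI impI ind)+
    show "(\<lambda>i. coset (g i)) ` I \<subseteq> carrier H" using I by (auto simp: carrier_H)
    show "quotient.dim \<le> card ((\<lambda>i. coset (g i)) ` I)" by (simp only: dim card_image[OF inj])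
  qed (simp_all only: I(1) finite_imageI fin_dim_H[OF fin])
  ultimately show ?thesis by blast
qed

lemma dim_of_basis_coset:
  assumes "finite I" "inj_on (\<lambda>i. coset (g i)) I" "quotient.basis ((\<lambda>i. coset (g i)) ` I)"
  shows "quotient.dim = card I"
  using quotient.dim_basis[OF finite_imageI[OF assms(1)] assms(3)] card_image[OF assms(2)] by argo

end

section \<open>Chains supported in a set of cells\<close>

lemma chains_iff: "x \<in> chains A \<longleftrightarrow> (\<forall>c. c \<notin> A \<longrightarrow> x c = 0)"
  by (auto simp: chains_def supp_def)

lemma chain_subspace_chains: "chain_subspace (chains A)"
  by (simp add: chain_subspace_def chains_iff)

lemma finite_chains:
  assumes "finite A"
  shows "finite (chains A)"
proof (rule inj_on_finite)
  show "inj_on supp (chains A)"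
  proof (rule inj_onI)
    fix x y :: "'c chain"
    assume "supp x = supp y"
    \<comment> \<open>Over two coefficients a chain is determined by its support.\<close>
    then have "x c = 0 \<longleftrightarrow> y c = 0" for c unfolding supp_def by blast
    then show "x = y" using bit_not_zero_iff by (intro ext) metis
  qed
  show "supp ` chains A \<subseteq> Pow A" by (auto simp: chains_def)
qed (use assms in simp)

lemma cell_chain_in_chains: "cell_chain \<tau> \<in> chains A \<longleftrightarrow> \<tau> \<in> A"
  by (auto simp: chains_iff cell_chain_def)

section \<open>Homology of a complex\<close>

locale finite_cell_complex =
  fixes n :: nat and K :: "'c cell_complex"
  assumes is_complex: "cell_complex n K"
begin

lemma finite_cells: "finite (cells K q)"
  using is_complex by (simp add: cell_complex_def)

lemma finite_all_cells: "finite (all_cells K)"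
proof -
  have "cells K q = {}" if "\<not> q \<le> n" for q
    using is_complex that by (simp add: cell_complex_def)
  then have "all_cells K = (\<Union>q\<le>n. cells K q)"
    unfolding all_cells_def by blast
  then show ?thesis by (simp add: finite_cells)
qed

lemma cells_disjoint: "c \<in> cells K p \<Longrightarrow> c \<in> cells K q \<Longrightarrow> p = q"
  using is_complex unfolding cell_complex_def by blast

lemma cells_subset_all: "cells K q \<subseteq> all_cells K"
  by (auto simp: all_cells_def)

lemma bdry_add: "bdry K (x + y) = bdry K x + bdry K y"
  by (simp add: bdry_def fun_eq_iff distrib_left sum.distrib)

lemma bdry_zero [simp]: "bdry K 0 = 0"
  by (simp add: bdry_def fun_eq_iff)

lemma bdry_cell: "\<tau> \<in> all_cells K \<Longrightarrow> \<sigma> \<in> all_cells K \<Longrightarrow> bdry K (cell_chain \<tau>) \<sigma> = incidence K \<tau> \<sigma>"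
proof -
  assume mem: "\<tau> \<in> all_cells K" "\<sigma> \<in> all_cells K"
  have "(\<Sum>\<tau>'\<in>all_cells K. incidence K \<tau>' \<sigma> * cell_chain \<tau> \<tau>')
      = (\<Sum>\<tau>'\<in>all_cells K. if \<tau>' = \<tau> then incidence K \<tau>' \<sigma> else 0)"
    by (rule sum.cong) (simp_all add: cell_chain_def)
  then show ?thesis
    using mem finite_all_cells by (simp add: bdry_def)
qed

text \<open>The axioms of \<open>cell_complex\<close> concern boundaries of chains; applied to the
  chain of a single cell they constrain the degrees of incident cells.\<close>

lemma incidence_degree:
  assumes "\<tau> \<in> cells K p" "\<sigma> \<in> all_cells K" "incidence K \<tau> \<sigma> \<noteq> 0"
  obtains r where "p = Suc r" "\<sigma> \<in> cells K r"
proof -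
  have nz: "bdry K (cell_chain \<tau>) \<sigma> \<noteq> 0"
    using assms bdry_cell[of \<tau> \<sigma>] cells_subset_all[of p] by (simp add: subset_eq)
  have mem: "cell_chain \<tau> \<in> chains (cells K p)"
    using assms by (simp add: cell_chain_in_chains)
  show thesis
  proof (cases p)
    case 0
    then have "bdry K (cell_chain \<tau>) = 0"
      using mem is_complex unfolding cell_complex_def by blast
    then show ?thesis using nz by simp
  next
    case (Suc r)
    then have "bdry K (cell_chain \<tau>) \<in> chains (cells K r)"
      using mem is_complex unfolding cell_complex_def by blast
    then show ?thesis using that[of r] Suc nz unfolding chains_iff by blast
  qed
qed

lemma bdry_bdry: "x \<in> chains (all_cells K) \<Longrightarrow> bdry K (bdry K x) = 0"
  using is_complex by (simp add: cell_complex_def)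

lemma chains_cells_subset: "chains (cells K q) \<subseteq> chains (all_cells K)"
  using cells_subset_all by (auto simp: chains_def)

lemma chain_subspace_cycles: "chain_subspace (cycles K q)"
  using chain_subspace_chains[of "cells K q"] by (simp add: chain_subspace_def cycles_def bdry_add)

lemma chain_subspace_boundaries: "chain_subspace (boundaries K q)"
proof -
  have "0 \<in> boundaries K q"
    unfolding boundaries_def using chain_subspace_chains[of "cells K (Suc q)"]
    by (intro image_eqI[of _ _ 0]) (simp_all add: chain_subspace_def)
  moreover have "bdry K x + bdry K y \<in> boundaries K q"
    if "x \<in> chains (cells K (Suc q))" "y \<in> chains (cells K (Suc q))" for x y
    unfolding boundaries_def using chain_subspace_chains[of "cells K (Suc q)"] that
    by (intro image_eqI[of _ _ "x + y"]) (simp_all add: chain_subspace_def bdry_add)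
  ultimately show ?thesis
    unfolding chain_subspace_def boundaries_def by blast
qed

lemma boundaries_subset_cycles: "boundaries K q \<subseteq> cycles K q"
proof -
  have "bdry K x \<in> cycles K q" if "x \<in> chains (cells K (Suc q))" for x
    using that is_complex chains_cells_subset[of "Suc q"] bdry_bdry[of x]
    unfolding cycles_def cell_complex_def by blast
  then show ?thesis unfolding boundaries_def by blast
qed

lemma chain_pair_homology: "chain_pair (cycles K q) (boundaries K q)"
  by (intro chain_pair.intro boundaries_subset_cycles chain_subspace_cycles chain_subspace_boundaries)

lemma homology_class_eq: "homology_class K q = chain_pair.coset (cycles K q) (boundaries K q)"
  by (simp add: fun_eq_iff homology_class_def chain_pair.coset_def[OF chain_pair_homology])

lemma finite_cycles: "finite (cycles K q)"
  by (rule finite_subset[OF _ finite_chains[OF finite_cells]]) (auto simp: cycles_def)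

text \<open>Frees homology bases from the quotient, leaving independence and generation of chains
  modulo boundaries.\<close>

lemma homology_basis_iff:
  "homology_basis K q \<beta> g \<longleftrightarrow>
     (\<forall>i\<in>{1..\<beta>}. g i \<in> cycles K q) \<and>
     (\<forall>a. chain_comb a g {1..\<beta>} \<in> boundaries K q \<longrightarrow> (\<forall>i\<in>{1..\<beta>}. a i = 0)) \<and>
     (\<forall>z\<in>cycles K q. \<exists>a. z + chain_comb a g {1..\<beta>} \<in> boundaries K q)"
proof (cases "\<forall>i\<in>{1..\<beta>}. g i \<in> cycles K q")
  case True
  then have "g i \<in> cycles K q" if "i \<in> {1..\<beta>}" for i using that by blast
  note * = chain_pair.basis_coset_iff[where I = "{1..\<beta>}" and g = g,
      OF chain_pair_homology finite_atLeastAtMost this]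
  have "inj_on (\<lambda>i. homology_class K q (g i)) {1..\<beta>} \<and>
      vectorspace.basis class_ring (homology K q) ((\<lambda>i. homology_class K q (g i)) ` {1..\<beta>}) \<longleftrightarrow>
      (\<forall>a. chain_comb a g {1..\<beta>} \<in> boundaries K q \<longrightarrow> (\<forall>i\<in>{1..\<beta>}. a i = 0)) \<and>
      (\<forall>z\<in>cycles K q. \<exists>a. z + chain_comb a g {1..\<beta>} \<in> boundaries K q)"
    unfolding homology_def homology_class_eq by (rule *)
  then show ?thesis
    unfolding homology_basis_def using True by argo
next
  case False
  then show ?thesis unfolding homology_basis_def by argo
qed

lemma betti_eq_of_homology_basis:
  assumes "homology_basis K q \<beta> g"
  shows "betti K q = \<beta>"
  using chain_pair.dim_of_basis_coset[OF chain_pair_homology, of "{1..\<beta>}" q g] assms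
  unfolding homology_basis_def homology_def homology_class_eq betti_def by simp

lemma homology_basis_of_betti_eq:
  assumes "\<And>i. i \<in> {1..\<beta>} \<Longrightarrow> g i \<in> cycles K q"
    and "\<And>a. chain_comb a g {1..\<beta>} \<in> boundaries K q \<Longrightarrow> \<forall>i\<in>{1..\<beta>}. a i = 0"
    and "betti K q = \<beta>"
  shows "homology_basis K q \<beta> g"
proof -
  have "vectorspace.dim class_ring (homology K q) = card {1..\<beta>}"
    using assms(3) unfolding betti_def by simp
  from chain_pair.basis_coset_of_dim[OF chain_pair_homology finite_atLeastAtMost assms(1) finite_cycles
      assms(2) this[unfolded homology_def]]
  show ?thesis
    unfolding homology_basis_def homology_def homology_class_eq using assms(1) by simp
qed

end

section \<open>Generated subcomplexes\<close>

lemma generated_subcomplex_cells: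
  "cells (generated_subcomplex K A) p = cells K p \<inter> \<Inter>{B. spans_subcomplex K B \<and> A \<subseteq> B}"
  by (simp add: generated_subcomplex_def)

context finite_cell_complex
begin

lemma bdry_in_all: "bdry K x \<in> chains (all_cells K)"
  by (simp add: chains_iff bdry_def)

lemma spans_subcomplex_all: "spans_subcomplex K (all_cells K)"
  using bdry_in_all by (auto simp: spans_subcomplex_def)

text \<open>Makes the intersection in \<open>generated_subcomplex\<close> a subcomplex
  itself.\<close>

lemma spans_subcomplex_Inter:
  assumes "\<B> \<noteq> {}" "\<And>B. B \<in> \<B> \<Longrightarrow> spans_subcomplex K B"
  shows "spans_subcomplex K (\<Inter>\<B>)"
proof -
  have "bdry K x \<in> chains B" if "B \<in> \<B>" "x \<in> chains (\<Inter>\<B>)" for x B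
  proof -
    have "x \<in> chains B" using that unfolding chains_def by blast
    then show ?thesis using assms(2)[OF that(1)] unfolding spans_subcomplex_def by blast
  qed
  then have "bdry K ` chains (\<Inter>\<B>) \<subseteq> chains (\<Inter>\<B>)"
    unfolding chains_def by blast
  then show ?thesis
    using assms unfolding spans_subcomplex_def by blast
qed

text \<open>
  By this bound the subcomplex generated by a set of \<open>q\<close>-cells has no further \<open>q\<close>-cells and no
  \<open>(q + 1)\<close>-cells: its \<open>q\<close>-homology is its space of \<open>q\<close>-cycles.
\<close>

lemma spans_subcomplex_lower:
  assumes "A \<subseteq> cells K q"
  shows "spans_subcomplex K (A \<union> (\<Union>p<q. cells K p))"
proof -
  have "\<sigma> \<in> (\<Union>p<q. cells K p)"
    if x: "x \<in> chains (A \<union> (\<Union>p<q. cells K p))" and nz: "bdry K x \<sigma> \<noteq> 0" for x \<sigma>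
  proof -
    from nz have \<sigma>: "\<sigma> \<in> all_cells K" and "(\<Sum>\<tau>\<in>all_cells K. incidence K \<tau> \<sigma> * x \<tau>) \<noteq> 0"
      by (auto simp: bdry_def split: if_splits)
    then obtain \<tau> where \<tau>: "incidence K \<tau> \<sigma> * x \<tau> \<noteq> 0"
      by (meson sum.neutral)
    then have nz: "incidence K \<tau> \<sigma> \<noteq> 0" "x \<tau> \<noteq> 0" by auto
    from nz(2) have "\<tau> \<in> A \<union> (\<Union>p<q. cells K p)"
      using x unfolding chains_iff by blast
    then have "\<exists>p\<le>q. \<tau> \<in> cells K p"
      using assms by (auto intro: less_imp_le)
    then obtain p where p: "p \<le> q" "\<tau> \<in> cells K p" by blast
    obtain r where "p = Suc r" "\<sigma> \<in> cells K r"
      using incidence_degree[OF p(2) \<sigma> nz(1)] by blast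
    then show ?thesis using p(1) by auto
  qed
  then have "bdry K ` chains (A \<union> (\<Union>p<q. cells K p)) \<subseteq> chains (A \<union> (\<Union>p<q. cells K p))"
    by (intro image_subsetI, subst chains_iff) blast
  then show ?thesis
    using assms cells_subset_all unfolding spans_subcomplex_def by blast
qed

text \<open>The boundary map of the subcomplex sums over fewer cells and is cut off outside
  \<open>G\<close>. Neither changes the value: \<open>x\<close> vanishes outside \<open>G\<close>,
  and \<open>G\<close> is closed under the boundary.\<close>

lemma bdry_generated_subcomplex:
  fixes A
  defines "G \<equiv> \<Inter>{B. spans_subcomplex K B \<and> A \<subseteq> B}"
  assumes A: "A \<subseteq> cells K q" and x: "x \<in> chains G"
  shows "bdry (generated_subcomplex K A) x = bdry K x"
proof
  fix \<sigma>
  have "spans_subcomplex K (all_cells K) \<and> A \<subseteq> all_cells K"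
    using spans_subcomplex_all A cells_subset_all[of q] by blast
  then have spans: "spans_subcomplex K G"
    unfolding G_def by (intro spans_subcomplex_Inter) blast+
  then have G: "G \<subseteq> all_cells K" "bdry K x \<in> chains G"
    using x unfolding spans_subcomplex_def by blast+
  have all: "all_cells (generated_subcomplex K A) = G"
    using G(1) by (auto simp: all_cells_def generated_subcomplex_cells G_def)
  have inc: "incidence (generated_subcomplex K A) = incidence K"
    by (simp add: generated_subcomplex_def)
  have sum: "(\<Sum>\<tau>\<in>G. incidence K \<tau> \<sigma> * x \<tau>) = (\<Sum>\<tau>\<in>all_cells K. incidence K \<tau> \<sigma> * x \<tau>)"
    using x by (intro sum.mono_neutral_left finite_all_cells G(1)) (simp add: chains_iff)
  show "bdry (generated_subcomplex K A) x \<sigma> = bdry K x \<sigma>"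
  proof (cases "\<sigma> \<in> G")
    case True
    then show ?thesis using G(1) by (simp add: bdry_def all inc sum subset_eq)
  next
    case False
    then show ?thesis using G(2) by (simp add: bdry_def all chains_iff)
  qed
qed

text \<open>The axioms of a complex restrict to \<open>G\<close>, and in degrees \<open>q\<close>
  and \<open>q + 1\<close> the cells of \<open>G\<close> are known exactly.\<close>

lemma generated_subcomplex_homology:
  assumes A: "A \<subseteq> cells K q"
  shows "finite_cell_complex n (generated_subcomplex K A)"
    and "cycles (generated_subcomplex K A) q = cycles K q \<inter> chains A"
    and "boundaries (generated_subcomplex K A) q = {0}"
proof -
  define G where "G = \<Inter>{B. spans_subcomplex K B \<and> A \<subseteq> B}"
  let ?K = "generated_subcomplex K A"
  have "spans_subcomplex K (all_cells K) \<and> A \<subseteq> all_cells K"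
    using spans_subcomplex_all A cells_subset_all[of q] by blast
  then have spans: "spans_subcomplex K G"
    unfolding G_def by (intro spans_subcomplex_Inter) blast+
  then have G: "G \<subseteq> all_cells K" "\<And>x. x \<in> chains G \<Longrightarrow> bdry K x \<in> chains G"
    unfolding spans_subcomplex_def by blast+
  have cells: "cells ?K p = cells K p \<inter> G" for p
    by (simp add: generated_subcomplex_cells G_def)
  have all: "all_cells ?K = G"
    using G(1) by (auto simp: all_cells_def cells)
  have bdry: "bdry ?K x = bdry K x" if "x \<in> chains G" for x
    using bdry_generated_subcomplex[OF A, folded G_def, OF that] .
  have sub: "x \<in> chains G" "x \<in> chains (cells K p)" if "x \<in> chains (cells K p \<inter> G)" for x p
    using that unfolding chains_def by blast+
  \<comment> \<open>The set from \<open>spans_subcomplex_lower\<close> is one of those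
    intersected.\<close>
  have low: "G \<subseteq> A \<union> (\<Union>p<q. cells K p)"
    unfolding G_def using spans_subcomplex_lower[OF A] by blast
  have "A \<subseteq> G" unfolding G_def by blast
  then have cells_q: "cells ?K q = A"
    using low A cells_disjoint[of _ _ q] unfolding cells by blast
  have cells_Suc: "cells ?K (Suc q) = {}"
    using low A cells_disjoint[of _ _ "Suc q"] unfolding cells by fastforce
  have 1: "\<forall>x\<in>chains (cells ?K 0). bdry ?K x = 0"
    using is_complex sub bdry unfolding cells cell_complex_def by metis
  have 2: "\<forall>x\<in>chains (cells ?K (Suc p)). bdry ?K x \<in> chains (cells ?K p)" for p
  proof
    fix x assume "x \<in> chains (cells ?K (Suc p))"
    then have x: "x \<in> chains G" "x \<in> chains (cells K (Suc p))"
      using sub unfolding cells by blast+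
    then have "bdry K x \<in> chains (cells K p)" "bdry K x \<in> chains G"
      using G(2) is_complex unfolding cell_complex_def by blast+
    then show "bdry ?K x \<in> chains (cells ?K p)"
      unfolding bdry[OF x(1)] cells chains_def by blast
  qed
  have 3: "\<forall>x\<in>chains (all_cells ?K). bdry ?K (bdry ?K x) = 0"
  proof
    fix x assume "x \<in> chains (all_cells ?K)"
    then have x: "x \<in> chains G" by (simp only: all)
    then have "x \<in> chains (all_cells K)" using G(1) unfolding chains_def by blast
    then show "bdry ?K (bdry ?K x) = 0"
      using bdry[OF x] bdry[OF G(2)[OF x]] bdry_bdry by metis
  qed
  have 4: "finite (cells ?K p)" "p \<noteq> r \<Longrightarrow> cells ?K p \<inter> cells ?K r = {}"
    "p > n \<Longrightarrow> cells ?K p = {}" for p r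
    using is_complex finite_cells unfolding cells cell_complex_def by (blast+)
  show "finite_cell_complex n ?K"
    unfolding finite_cell_complex_def cell_complex_def using 1 2 3 4 by blast
  have "x \<in> cycles ?K q \<longleftrightarrow> x \<in> cycles K q \<inter> chains A" for x
  proof -
    have "x \<in> chains A \<Longrightarrow> x \<in> chains G \<and> x \<in> chains (cells K q)"
      using A \<open>A \<subseteq> G\<close> unfolding chains_def by blast
    then show ?thesis unfolding cycles_def cells_q using bdry by auto
  qed
  then show "cycles ?K q = cycles K q \<inter> chains A" by blast
  have "chains {} = {0 :: 'c chain}"
    by (auto simp: chains_iff fun_eq_iff)
  then show "boundaries ?K q = {0}"
    unfolding boundaries_def cells_Suc by (auto simp: bdry_def fun_eq_iff)
qed

text \<open>The \<open>g i\<close> are cycles of the subcomplex and remain independent there, where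
  all boundaries vanish. So the Betti number is \<open>\<beta>\<close> iff they form a basis, and
  all that is left of this is generation.\<close>

lemma betti_generated_subcomplex_iff:
  assumes g: "homology_basis K q \<beta> g"
  defines "A \<equiv> \<Union>i\<in>{1..\<beta>}. supp (g i)"
  shows "betti (generated_subcomplex K A) q = \<beta> \<longleftrightarrow>
    (\<forall>z\<in>cycles K q \<inter> chains A. \<exists>a. z = chain_comb a g {1..\<beta>})"
proof -
  let ?K = "generated_subcomplex K A"
  have g_cyc: "g i \<in> cycles K q" if "i \<in> {1..\<beta>}" for i
    using g that by (simp add: homology_basis_def)
  have g_ind: "\<forall>i\<in>{1..\<beta>}. a i = 0" if "chain_comb a g {1..\<beta>} \<in> boundaries K q" for a
    using g that unfolding homology_basis_iff by simp
  have "supp (g i) \<subseteq> cells K q" if "i \<in> {1..\<beta>}" for i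
    using g_cyc[OF that] unfolding cycles_def chains_def by blast
  then have A: "A \<subseteq> cells K q" unfolding A_def by blast
  note sub = generated_subcomplex_homology[OF A]
  interpret sub: finite_cell_complex n ?K by (rule sub(1))
  have cyc: "g i \<in> cycles ?K q" if "i \<in> {1..\<beta>}" for i
    unfolding sub(2) using g_cyc[OF that] that by (auto simp: chains_def A_def)
  \<comment> \<open>Independence modulo the boundaries of \<open>K\<close> implies independence
    modulo zero.\<close>
  have "0 \<in> boundaries K q"
    using chain_subspace_boundaries[of q] by (simp add: chain_subspace_def)
  then have ind: "\<forall>i\<in>{1..\<beta>}. a i = 0" if "chain_comb a g {1..\<beta>} \<in> boundaries ?K q" for a
    using g_ind[of a] that unfolding sub(3) by simp
  have "betti ?K q = \<beta> \<longleftrightarrow> homology_basis ?K q \<beta> g"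
  proof
    assume "betti ?K q = \<beta>"
    with cyc ind show "homology_basis ?K q \<beta> g"
      by (rule sub.homology_basis_of_betti_eq)
  qed (rule sub.betti_eq_of_homology_basis)
  also have "\<dots> \<longleftrightarrow> (\<forall>z\<in>cycles ?K q. \<exists>a. z + chain_comb a g {1..\<beta>} \<in> boundaries ?K q)"
    unfolding sub.homology_basis_iff by (simp add: cyc ind)
  finally show ?thesis
    unfolding sub(2,3) singleton_iff chain_add_eq_0_iff .
qed

section \<open>Trees and cotrees\<close>

lemma chains_ker_bdry: "A \<subseteq> cells K q \<Longrightarrow> chains A \<inter> ker_bdry K = chains A \<inter> cycles K q"
  using chains_cells_subset[of q] unfolding ker_bdry_def cycles_def chains_def by blast

lemma q_tree_iff: "q_tree K q A \<longleftrightarrow> A \<subseteq> cells K q \<and> (\<forall>x\<in>chains A \<inter> cycles K q. x = 0)"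
proof -
  have "0 \<in> chains A \<inter> cycles K q"
    using chain_subspace_chains[of A] chain_subspace_cycles[of q] by (simp add: chain_subspace_def)
  then show ?thesis
    unfolding q_tree_def using chains_ker_bdry by blast
qed

lemma q_cotree_iff:
  "q_cotree K q A \<longleftrightarrow> A \<subseteq> cells K q \<and> (\<forall>x\<in>chains A \<inter> ker_cobdry K. x = 0)"
proof -
  have "0 \<in> chains A \<inter> ker_cobdry K"
    by (simp add: chains_iff ker_cobdry_def cobdry_def fun_eq_iff)
  then show ?thesis unfolding q_cotree_def by blast
qed

lemma q_tree_extends:
  assumes "q_tree K q S"
  obtains T where "S \<subseteq> T" "maximal_q_tree K q T"
proof -
  have "finite {A. q_tree K q A}"
    by (rule finite_subset[of _ "Pow (cells K q)"]) (auto simp: q_tree_def finite_cells)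
  from finite_has_maximal2[OF this, of S] assms
  obtain T where T: "q_tree K q T" "S \<subseteq> T" "\<And>B. q_tree K q B \<Longrightarrow> T \<subseteq> B \<Longrightarrow> T = B"
    by auto
  have "\<not> T \<subset> B" if "q_tree K q B" for B
    using T(3)[OF that] by (simp add: psubset_eq)
  then have "maximal_q_tree K q T"
    using T(1) unfolding maximal_q_tree_def by blast
  with T(2) show thesis by (rule that)
qed

text \<open>Two cycles that both differ from \<open>\<tau>\<close> by a chain on \<open>T\<close>
  differ from each other by a cycle on the tree \<open>T\<close>, which is zero. This evaluates the
  definite description.\<close>

lemma induced_cycle_eqI:
  assumes T: "q_tree K q T" and z: "z \<in> cycles K q" "z = cell_chain \<tau> + a" "a \<in> chains T"
  shows "induced_cycle K q T \<tau> = z"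
  unfolding induced_cycle_def
proof (rule the_equality)
  fix w assume w: "w \<in> cycles K q \<and> (\<exists>a\<in>chains T. w = cell_chain \<tau> + a)"
  then obtain b where b: "b \<in> chains T" "w = cell_chain \<tau> + b" by blast
  have "w + z = b + a"
    unfolding b(2) z(2) by (simp add: ac_simps)
  then have "w + z \<in> chains T"
    using chain_subspace_chains[of T] b(1) z(3) by (simp add: chain_subspace_def)
  moreover have "w + z \<in> cycles K q"
    using chain_subspace_cycles[of q] w z(1) by (simp add: chain_subspace_def)
  ultimately have "w + z = 0"
    using T unfolding q_tree_iff by blast
  then show "w = z" by (simp only: chain_add_eq_0_iff)
qed (use z in blast)

text \<open>By maximality \<open>insert \<tau> T\<close> carries a nonzero cycle, which must contain
  \<open>\<tau>\<close> because \<open>T\<close> alone carries none.\<close>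

lemma fundamental_cycle:
  assumes T: "maximal_q_tree K q T" and \<tau>: "\<tau> \<in> cells K q - T"
  obtains z a where "z \<in> cycles K q" "z = cell_chain \<tau> + a" "a \<in> chains T"
proof -
  have tree: "q_tree K q T" and "\<not> q_tree K q (insert \<tau> T)"
    using T \<tau> unfolding maximal_q_tree_def by blast+
  then obtain z where z: "z \<in> chains (insert \<tau> T)" "z \<in> cycles K q" "z \<noteq> 0"
    using \<tau> unfolding q_tree_iff by blast
  have "z \<tau> = 1"
  proof (rule ccontr)
    assume "z \<tau> \<noteq> 1"
    then have "z \<in> chains T"
      using z(1) by (auto simp: chains_iff)
    then show False using tree z unfolding q_tree_iff by blast
  qed
  then have "cell_chain \<tau> + z \<in> chains T"
    using z(1) by (auto simp: chains_iff cell_chain_def)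
  then show thesis
    using that[of z "cell_chain \<tau> + z"] z(2) by simp
qed

text \<open>Boundary and coboundary are transposes for the standard pairing, and boundaries of
  single cells suffice to test whether a coboundary vanishes.\<close>

lemma ker_cobdry_iff:
  assumes x: "x \<in> chains (cells K q)"
  shows "x \<in> ker_cobdry K \<longleftrightarrow> (\<forall>b\<in>boundaries K q. (\<Sum>c\<in>cells K q. x c * b c) = 0)"
proof -
  have restrict: "(\<Sum>c\<in>cells K q. x c * y c) = (\<Sum>c\<in>all_cells K. x c * y c)" for y :: "'c chain"
    using x by (intro sum.mono_neutral_left finite_all_cells cells_subset_all) (simp add: chains_iff)
  have adjoint: "(\<Sum>c\<in>all_cells K. x c * bdry K y c) = (\<Sum>c\<in>all_cells K. cobdry K x c * y c)" for y
  proof -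
    have "(\<Sum>c\<in>all_cells K. x c * bdry K y c)
        = (\<Sum>c\<in>all_cells K. \<Sum>\<tau>\<in>all_cells K. x c * (incidence K \<tau> c * y \<tau>))"
      by (rule sum.cong) (simp_all add: bdry_def sum_distrib_left)
    also have "\<dots> = (\<Sum>\<tau>\<in>all_cells K. \<Sum>c\<in>all_cells K. x c * (incidence K \<tau> c * y \<tau>))"
      by (rule sum.swap)
    also have "\<dots> = (\<Sum>\<tau>\<in>all_cells K. cobdry K x \<tau> * y \<tau>)"
      by (rule sum.cong) (simp_all add: cobdry_def sum_distrib_left ac_simps)
    finally show ?thesis .
  qed
  show ?thesis
  proof
    assume "x \<in> ker_cobdry K"
    then show "\<forall>b\<in>boundaries K q. (\<Sum>c\<in>cells K q. x c * b c) = 0"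
      by (auto simp: boundaries_def restrict adjoint ker_cobdry_def)
  next
    assume orth: "\<forall>b\<in>boundaries K q. (\<Sum>c\<in>cells K q. x c * b c) = 0"
    have "cobdry K x \<tau> = 0" for \<tau>
    proof (cases "\<tau> \<in> all_cells K")
      case True
      then have cob: "cobdry K x \<tau> = (\<Sum>c\<in>all_cells K. x c * bdry K (cell_chain \<tau>) c)"
        by (simp add: cobdry_def bdry_cell mult.commute)
      show ?thesis
      proof (cases "\<tau> \<in> cells K (Suc q)")
        case True
        then have "bdry K (cell_chain \<tau>) \<in> boundaries K q"
          unfolding boundaries_def by (intro imageI) (simp add: cell_chain_in_chains)
        then show ?thesis using orth by (simp add: cob restrict)
      next
        case False
        \<comment> \<open>A cell of degree other than \<open>q + 1\<close> has no faces of degree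
          \<open>q\<close>, where \<open>x\<close> lives.\<close>
        have "incidence K \<tau> c * x c = 0" if c: "c \<in> all_cells K" for c
        proof (rule ccontr)
          assume nz: "incidence K \<tau> c * x c \<noteq> 0"
          then have "c \<in> cells K q" using x by (auto simp: chains_iff)
          moreover from True obtain p where p: "\<tau> \<in> cells K p" by (auto simp: all_cells_def)
          from nz have "incidence K \<tau> c \<noteq> 0" by auto
          from incidence_degree[OF p c this] obtain r where "p = Suc r" "c \<in> cells K r" .
          ultimately show False using False p cells_disjoint by blast
        qed
        then show ?thesis using True by (simp add: cobdry_def)
      qed
    qed (simp add: cobdry_def)
    then have "cobdry K x = 0" by (simp add: fun_eq_iff)
    then show "x \<in> ker_cobdry K"
      using x chains_cells_subset[of q] unfolding ker_cobdry_def by blast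
  qed
qed

text \<open>A family of boundaries dual to the cells of \<open>C\<close> replaces a dimension count:
  it shows that \<open>C\<close> carries no nonzero cocycle and yields a nonzero one on every larger
  set of cells.\<close>

lemma maximal_cotree_complement:
  assumes T: "maximal_q_tree K q T"
    and g: "homology_basis K q \<beta> g"
    and \<epsilon>: "inj_on \<epsilon> {1..\<beta>}" "\<epsilon> ` {1..\<beta>} \<inter> T = {}"
    and g_supp: "\<And>i. i \<in> {1..\<beta>} \<Longrightarrow> g i \<in> chains (insert (\<epsilon> i) T)"
    and g_\<epsilon>: "\<And>i. i \<in> {1..\<beta>} \<Longrightarrow> g i (\<epsilon> i) = 1"
  shows "maximal_q_cotree K q (cells K q - T - \<epsilon> ` {1..\<beta>})"
proof -
  define C where "C = cells K q - T - \<epsilon> ` {1..\<beta>}"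
  let ?I = "{1..\<beta>}"
  have C: "C \<subseteq> cells K q" "finite C"
    using finite_cells[of q] by (auto simp: C_def)
  have tree: "q_tree K q T" using T by (simp add: maximal_q_tree_def)
  have g_cyc: "g i \<in> cycles K q" if "i \<in> ?I" for i
    using g that by (simp add: homology_basis_def)
  have g_ind: "\<forall>i\<in>?I. a i = 0" if "chain_comb a g ?I \<in> boundaries K q" for a
    using g that unfolding homology_basis_iff by simp
  have g_gen: "\<exists>a. z + chain_comb a g ?I \<in> boundaries K q" if "z \<in> cycles K q" for z
    using g that unfolding homology_basis_iff by simp
  have comb_C: "chain_comb a g ?I c = 0" if "c \<in> C" for a c
  proof -
    have "g i c = 0" if "i \<in> ?I" for i
      using g_supp[OF that] \<open>c \<in> C\<close> that unfolding chains_iff C_def by blast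
    then show ?thesis by (simp add: chain_comb_def)
  qed
  have comb_\<epsilon>: "chain_comb a g ?I (\<epsilon> j) = a j" if j: "j \<in> ?I" for a j
  proof -
    have "g i (\<epsilon> j) = (if i = j then 1 else 0)" if "i \<in> ?I" for i
    proof (cases "i = j")
      case False
      then have "\<epsilon> j \<notin> insert (\<epsilon> i) T"
        using \<epsilon> that j inj_on_eq_iff[OF \<epsilon>(1) j that] by blast
      then have "g i (\<epsilon> j) = 0" using g_supp[OF that] unfolding chains_iff by blast
      then show ?thesis using False by simp
    next
      case True
      then show ?thesis using g_\<epsilon>[OF j] by simp
    qed
    then show ?thesis by (rule chain_comb_apply_delta[OF finite_atLeastAtMost j])
  qed
  \<comment> \<open>This and the next claim say that restriction to \<open>C\<close> maps the boundaries isomorphically onto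
    \<open>chains C\<close>; by duality \<open>C\<close> is then a maximal cotree.\<close>
  have inj: "b = 0" if b: "b \<in> boundaries K q" and b_C: "\<And>c. c \<in> C \<Longrightarrow> b c = 0" for b
  proof -
    \<comment> \<open>The subtracted coefficients are the values of \<open>b\<close> at the private
      cells, so \<open>d\<close> vanishes there. On \<open>C\<close> both summands vanish, which
      leaves a cycle on the tree \<open>T\<close>.\<close>
    define d where "d = b + chain_comb (\<lambda>i. b (\<epsilon> i)) g ?I"
    have b_cyc: "b \<in> cycles K q" using b boundaries_subset_cycles by blast
    have "chain_comb (\<lambda>i. b (\<epsilon> i)) g ?I \<in> cycles K q"
      by (rule chain_subspace_comb[OF chain_subspace_cycles]) (simp_all add: g_cyc)
    then have d: "d \<in> cycles K q"
      using b_cyc chain_subspace_cycles[of q] by (simp add: d_def chain_subspace_def)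
    have "d c = 0" if c: "c \<notin> T" for c
    proof -
      consider "c \<notin> cells K q" | "c \<in> C" | j where "j \<in> ?I" "c = \<epsilon> j"
        using c unfolding C_def by blast
      then show ?thesis
      proof cases
        case 1
        then show ?thesis using d by (simp add: cycles_def chains_iff)
      next
        case 2
        then show ?thesis unfolding d_def plus_fun_apply by (simp only: b_C comb_C add_0)
      next
        case 3
        then show ?thesis unfolding d_def plus_fun_apply by (simp only: comb_\<epsilon> bit_add_self)
      qed
    qed
    then have "d \<in> chains T" unfolding chains_iff by blast
    then have "d = 0"
      using tree d unfolding q_tree_iff by blast
    then have eq: "b = chain_comb (\<lambda>i. b (\<epsilon> i)) g ?I"
      by (simp only: d_def chain_add_eq_0_iff)
    \<comment> \<open>The combination is a boundary, so independence of the classes kills its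
      coefficients.\<close>
    have "\<forall>i\<in>?I. b (\<epsilon> i) = 0"
      using b eq by (intro g_ind) simp
    then have "chain_comb (\<lambda>i. b (\<epsilon> i)) g ?I = 0"
      by (intro chain_comb_zero) blast
    then show "b = 0" using eq by simp
  qed
  have "\<exists>b\<in>boundaries K q. \<forall>c\<in>C. b c = (if c = \<tau> then 1 else 0)" if \<tau>: "\<tau> \<in> C" for \<tau>
  proof -
    have "\<tau> \<in> cells K q - T" using \<tau> by (simp add: C_def)
    then obtain z a where z: "z \<in> cycles K q" "z = cell_chain \<tau> + a" "a \<in> chains T"
      using fundamental_cycle[OF T] by blast
    \<comment> \<open>\<open>z\<close> is homologous to a combination of the \<open>g i\<close>.
      Adding it makes a boundary and leaves the values on \<open>C\<close> unchanged.\<close>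
    obtain k where "z + chain_comb k g ?I \<in> boundaries K q"
      using g_gen[OF z(1)] by blast
    moreover have "(z + chain_comb k g ?I) c = (if c = \<tau> then 1 else 0)" if "c \<in> C" for c
    proof -
      have "a c = 0" using z(3) that unfolding chains_iff C_def by blast
      then show ?thesis unfolding z(2) plus_fun_apply comb_C[OF that] cell_chain_def by (simp only: add_0_right)
    qed
    ultimately show ?thesis by blast
  qed
  then obtain B where B: "\<And>\<tau>. \<tau> \<in> C \<Longrightarrow> B \<tau> \<in> boundaries K q"
    "\<And>\<tau> c. \<tau> \<in> C \<Longrightarrow> c \<in> C \<Longrightarrow> B \<tau> c = (if c = \<tau> then 1 else 0)"
    by metis
  have cotree: "q_cotree K q C"
    unfolding q_cotree_iff
  proof (intro conjI ballI)
    show "C \<subseteq> cells K q" by (rule C(1))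
    fix x assume "x \<in> chains C \<inter> ker_cobdry K"
    then have x: "x \<in> chains C" "x \<in> ker_cobdry K" by blast+
    have xq: "x \<in> chains (cells K q)" using x(1) C(1) unfolding chains_def by blast
    have "x \<tau> = 0" if \<tau>: "\<tau> \<in> C" for \<tau>
    proof -
      \<comment> \<open>Pairing with \<open>B \<tau>\<close> isolates the coefficient at
        \<open>\<tau>\<close>, and a cocycle pairs to zero with boundaries.\<close>
      have "0 = (\<Sum>c\<in>cells K q. x c * B \<tau> c)"
        using x(2) B(1)[OF \<tau>] unfolding ker_cobdry_iff[OF xq] by simp
      also have "\<dots> = (\<Sum>c\<in>C. x c * B \<tau> c)"
        using x(1) C finite_cells by (intro sum.mono_neutral_right) (simp_all add: chains_iff)
      also have "\<dots> = (\<Sum>c\<in>C. if c = \<tau> then x c else 0)"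
        by (rule sum.cong) (simp_all add: B(2)[OF \<tau>])
      also have "\<dots> = x \<tau>" using \<tau> C(2) by simp
      finally show ?thesis by simp
    qed
    then have "x c = 0" for c using x(1) unfolding chains_iff by blast
    then show "x = 0" by (simp add: fun_eq_iff)
  qed
  have "\<not> q_cotree K q D" if D: "C \<subset> D" for D
  proof
    assume D_cotree: "q_cotree K q D"
    obtain \<sigma> where \<sigma>: "\<sigma> \<in> D" "\<sigma> \<notin> C" using D by blast
    have \<sigma>q: "\<sigma> \<in> cells K q" using D_cotree \<sigma>(1) unfolding q_cotree_def by blast
    \<comment> \<open>The values on \<open>C\<close> are forced: the pairing with \<open>B c\<close>
      is \<open>B c \<sigma> + x c\<close>, which has to be zero.\<close>
    define x :: "'c chain" where "x = (\<lambda>c. if c = \<sigma> then 1 else if c \<in> C then B c \<sigma> else 0)"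
    have "x c = 0" if "c \<notin> insert \<sigma> C" for c
      using that by (simp add: x_def)
    then have supp_x: "supp x \<subseteq> insert \<sigma> C" unfolding supp_def by blast
    have xD: "x \<in> chains D" using supp_x \<sigma>(1) D unfolding chains_def by blast
    have xq: "x \<in> chains (cells K q)" using supp_x \<sigma>q C(1) unfolding chains_def by blast
    have "(\<Sum>c\<in>cells K q. x c * b c) = 0" if b: "b \<in> boundaries K q" for b
    proof -
      \<comment> \<open>\<open>b\<close> equals the combination of the \<open>B \<tau>\<close> with
        coefficients \<open>b \<tau>\<close>: the two agree on \<open>C\<close>, and restriction to
        \<open>C\<close> is injective on boundaries.\<close>
      define d where "d = b + chain_comb b B C"
      have "chain_comb b B C \<in> boundaries K q"
        by (rule chain_subspace_comb[OF chain_subspace_boundaries C(2)]) (rule B(1))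
      then have d: "d \<in> boundaries K q"
        using b chain_subspace_boundaries[of q] by (simp add: d_def chain_subspace_def)
      have "d c = 0" if "c \<in> C" for c
      proof -
        have "B \<tau> c = (if \<tau> = c then 1 else 0)" if "\<tau> \<in> C" for \<tau>
          using B(2)[OF that \<open>c \<in> C\<close>] by (simp add: eq_commute)
        then have "chain_comb b B C c = b c"
          by (rule chain_comb_apply_delta[OF C(2) \<open>c \<in> C\<close>])
        then show ?thesis unfolding d_def plus_fun_apply by (simp only: bit_add_self)
      qed
      then have "d = 0" by (rule inj[OF d])
      \<comment> \<open>Read at \<open>\<sigma>\<close>, the expansion of \<open>b\<close> is the
        orthogonality of \<open>x\<close> and \<open>b\<close>.\<close>
      then have "d \<sigma> = 0" by simp
      then have b\<sigma>: "b \<sigma> + (\<Sum>\<tau>\<in>C. b \<tau> * B \<tau> \<sigma>) = 0"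
        unfolding d_def plus_fun_apply chain_comb_def .
      have "(\<Sum>c\<in>cells K q. x c * b c) = (\<Sum>c\<in>insert \<sigma> C. x c * b c)"
      proof (rule sum.mono_neutral_right[OF finite_cells])
        show "insert \<sigma> C \<subseteq> cells K q" using \<sigma>q C(1) by blast
        show "\<forall>c\<in>cells K q - insert \<sigma> C. x c * b c = 0"
          by (simp add: x_def)
      qed
      also have "\<dots> = b \<sigma> + (\<Sum>c\<in>C. x c * b c)"
        using C(2) \<sigma>(2) by (simp add: x_def)
      also have "(\<Sum>c\<in>C. x c * b c) = (\<Sum>\<tau>\<in>C. b \<tau> * B \<tau> \<sigma>)"
      proof (rule sum.cong[OF refl])
        fix c assume "c \<in> C"
        then have "x c = B c \<sigma>" using \<sigma>(2) by (auto simp: x_def)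
        then show "x c * b c = b c * B c \<sigma>" by (simp only: mult.commute)
      qed
      finally show ?thesis using b\<sigma> by simp
    qed
    then have "x \<in> ker_cobdry K" unfolding ker_cobdry_iff[OF xq] by blast
    then have "x = 0" using D_cotree xD unfolding q_cotree_iff by blast
    then have "x \<sigma> = 0" by simp
    then show False by (simp add: x_def)
  qed
  then have "maximal_q_cotree K q C"
    using cotree unfolding maximal_q_cotree_def by blast
  then show ?thesis by (simp only: C_def)
qed

section \<open>Explicit bases and tri-partitions\<close>

lemma explicit_basis_iff:
  assumes "homology_basis K q \<beta> g"
  shows "explicit_basis K q \<beta> g \<longleftrightarrow>
    (\<forall>k\<in>{1..\<beta>}. supp (g k) - (\<Union>i\<in>{1..\<beta>} - {k}. supp (g i)) \<noteq> {}) \<and>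
    (\<forall>z\<in>cycles K q \<inter> chains (\<Union>i\<in>{1..\<beta>}. supp (g i)). \<exists>a. z = chain_comb a g {1..\<beta>})"
  unfolding explicit_basis_def betti_generated_subcomplex_iff[OF assms] ..

lemma tri_partition_of_explicit:
  assumes g: "homology_basis K q (betti K q) g" and expl: "explicit_basis K q (betti K q) g"
  shows "\<exists>C T E. tri_partition K q C T E \<and>
      (\<exists>\<epsilon>. bij_betw \<epsilon> {1..betti K q} E \<and>
        (\<forall>i\<in>{1..betti K q}. induced_cycle K q T (\<epsilon> i) = g i))"
proof -
  let ?I = "{1..betti K q}"
  define A where "A = (\<Union>i\<in>?I. supp (g i))"
  have g_cyc: "g i \<in> cycles K q" if "i \<in> ?I" for i
    using g that by (simp add: homology_basis_def)
  have "\<forall>k\<in>?I. \<exists>c. c \<in> supp (g k) - (\<Union>i\<in>?I - {k}. supp (g i))"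
    using expl unfolding explicit_basis_def by blast
  then obtain \<epsilon> where \<epsilon>: "\<And>k. k \<in> ?I \<Longrightarrow> \<epsilon> k \<in> supp (g k) - (\<Union>i\<in>?I - {k}. supp (g i))"
    by metis
  have own: "i = k" if "i \<in> ?I" "k \<in> ?I" "\<epsilon> k \<in> supp (g i)" for i k
    using \<epsilon>[OF that(2)] that by blast
  have inj: "inj_on \<epsilon> ?I"
  proof (rule inj_onI)
    fix i k assume "i \<in> ?I" "k \<in> ?I" "\<epsilon> i = \<epsilon> k"
    then show "i = k" using own[of i k] \<epsilon>[of i] by simp
  qed
  have g_\<epsilon>: "g i (\<epsilon> i) = 1" if "i \<in> ?I" for i
    using \<epsilon>[OF that] by (simp add: supp_def)
  have comb_\<epsilon>: "chain_comb a g ?I (\<epsilon> k) = a k" if k: "k \<in> ?I" for a k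
  proof -
    have "g i (\<epsilon> k) = (if i = k then 1 else 0)" if "i \<in> ?I" for i
    proof (cases "i = k")
      case False
      then have "g i (\<epsilon> k) = 0" using own[OF that k] unfolding supp_def by blast
      then show ?thesis using False by simp
    next
      case True
      then show ?thesis using g_\<epsilon>[OF k] by simp
    qed
    then show ?thesis by (rule chain_comb_apply_delta[OF finite_atLeastAtMost k])
  qed
  have A: "A \<subseteq> cells K q"
    using g_cyc unfolding A_def cycles_def chains_def by blast
  have tree: "q_tree K q (A - \<epsilon> ` ?I)"
    unfolding q_tree_iff
  proof (intro conjI ballI)
    show "A - \<epsilon> ` ?I \<subseteq> cells K q" using A by blast
    fix x assume "x \<in> chains (A - \<epsilon> ` ?I) \<inter> cycles K q"
    then have x: "x \<in> chains (A - \<epsilon> ` ?I)" "x \<in> cycles K q" by blast+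
    then have "x \<in> cycles K q \<inter> chains A" unfolding chains_def by blast
    \<comment> \<open>Explicitness writes \<open>x\<close> as a combination; its coefficients are
      the values of \<open>x\<close> at the private cells, which \<open>x\<close> avoids.\<close>
    then obtain a where a: "x = chain_comb a g ?I"
      using expl unfolding explicit_basis_iff[OF g] A_def by blast
    have "a k = 0" if "k \<in> ?I" for k
    proof -
      have "x (\<epsilon> k) = 0" using x(1) that unfolding chains_iff by blast
      then show ?thesis using a comb_\<epsilon>[OF that] by simp
    qed
    then show "x = 0" unfolding a by (rule chain_comb_zero)
  qed
  then obtain T where T: "A - \<epsilon> ` ?I \<subseteq> T" "maximal_q_tree K q T"
    by (rule q_tree_extends)
  have treeT: "q_tree K q T" using T(2) by (simp add: maximal_q_tree_def)
  \<comment> \<open>The only private cell in \<open>g i\<close> is its own; all its other cells were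
    put into \<open>T\<close>.\<close>
  have supp_g: "supp (g i) \<subseteq> insert (\<epsilon> i) T" if i: "i \<in> ?I" for i
  proof
    fix c assume c: "c \<in> supp (g i)"
    show "c \<in> insert (\<epsilon> i) T"
    proof (cases "c \<in> \<epsilon> ` ?I")
      case True
      then show ?thesis using own[OF i] c by blast
    next
      case False
      then have "c \<in> A - \<epsilon> ` ?I" using c i unfolding A_def by blast
      then show ?thesis using T(1) by blast
    qed
  qed
  \<comment> \<open>If the extension had picked up \<open>\<epsilon> i\<close>, the tree
    \<open>T\<close> would carry the nonzero cycle \<open>g i\<close>.\<close>
  have disj: "\<epsilon> ` ?I \<inter> T = {}"
  proof (rule ccontr)
    assume "\<epsilon> ` ?I \<inter> T \<noteq> {}"
    then obtain i where i: "i \<in> ?I" "\<epsilon> i \<in> T" by blast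
    then have "g i \<in> chains T" using supp_g[of i] unfolding chains_def by blast
    then have "g i = 0" using treeT g_cyc[OF i(1)] unfolding q_tree_iff by blast
    then show False using g_\<epsilon>[OF i(1)] by simp
  qed
  define C where "C = cells K q - T - \<epsilon> ` ?I"
  have C: "maximal_q_cotree K q C"
    unfolding C_def using T(2) g inj disj
  proof (rule maximal_cotree_complement)
    fix i assume "i \<in> ?I"
    then show "g i \<in> chains (insert (\<epsilon> i) T)" "g i (\<epsilon> i) = 1"
      using supp_g g_\<epsilon> unfolding chains_def by blast+
  qed
  have E: "\<epsilon> ` ?I \<subseteq> cells K q"
    using \<epsilon> A unfolding A_def by blast
  have "T \<subseteq> cells K q" using treeT unfolding q_tree_def by blast
  with E have "C \<union> T \<union> \<epsilon> ` ?I = cells K q" unfolding C_def by blast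
  moreover have "card (\<epsilon> ` ?I) = betti K q" using card_image[OF inj] by simp
  ultimately have "tri_partition K q C T (\<epsilon> ` ?I)"
    unfolding tri_partition_def using C T(2) disj unfolding C_def by blast
  moreover have "induced_cycle K q T (\<epsilon> i) = g i" if i: "i \<in> ?I" for i
  proof (rule induced_cycle_eqI[OF treeT g_cyc[OF i]])
    \<comment> \<open>In characteristic 2, adding the cell to \<open>g i\<close> removes it and
      leaves the tree part.\<close>
    show "g i = cell_chain (\<epsilon> i) + (cell_chain (\<epsilon> i) + g i)" by simp
    have "(cell_chain (\<epsilon> i) + g i) c = 0" if "c \<notin> T" for c
    proof (cases "c = \<epsilon> i")
      case True
      then show ?thesis by (simp add: cell_chain_def g_\<epsilon>[OF i])
    next
      case False
      then have "g i c = 0" using supp_g[OF i] that unfolding supp_def by blast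
      then show ?thesis using False by (simp add: cell_chain_def)
    qed
    then show "cell_chain (\<epsilon> i) + g i \<in> chains T" unfolding chains_iff by blast
  qed
  moreover have "bij_betw \<epsilon> ?I (\<epsilon> ` ?I)" using inj by (rule inj_on_imp_bij_betw)
  ultimately show ?thesis by blast
qed

lemma explicit_of_tri_partition:
  assumes g: "homology_basis K q (betti K q) g" and tri: "tri_partition K q C T E"
    and \<epsilon>: "bij_betw \<epsilon> {1..betti K q} E"
    and ind: "\<And>i. i \<in> {1..betti K q} \<Longrightarrow> induced_cycle K q T (\<epsilon> i) = g i"
  shows "explicit_basis K q (betti K q) g"
proof -
  let ?I = "{1..betti K q}"
  define A where "A = (\<Union>i\<in>?I. supp (g i))"
  have T: "maximal_q_tree K q T" and E: "E \<subseteq> cells K q - T"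
    using tri unfolding tri_partition_def by blast+
  have tree: "q_tree K q T" using T by (simp add: maximal_q_tree_def)
  have inj: "inj_on \<epsilon> ?I" and \<epsilon>_E: "\<epsilon> i \<in> E" if "i \<in> ?I" for i
    using \<epsilon> that unfolding bij_betw_def by blast+
  have \<epsilon>_T: "\<epsilon> i \<notin> T" if "i \<in> ?I" for i using \<epsilon>_E[OF that] E by blast
  have g_cyc: "g i \<in> cycles K q" if "i \<in> ?I" for i
    using g that by (simp add: homology_basis_def)
  have supp_g: "supp (g i) \<subseteq> insert (\<epsilon> i) T" and g_\<epsilon>: "g i (\<epsilon> i) = 1" if i: "i \<in> ?I" for i
  proof -
    have "\<epsilon> i \<in> cells K q - T" using \<epsilon>_E[OF i] E by blast
    then obtain z a where z: "z \<in> cycles K q" "z = cell_chain (\<epsilon> i) + a" "a \<in> chains T"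
      using fundamental_cycle[OF T] by blast
    \<comment> \<open>By uniqueness the definite description in \<open>ind\<close> is the cycle
      \<open>z\<close> just obtained.\<close>
    have gz: "g i = cell_chain (\<epsilon> i) + a"
      using ind[OF i] induced_cycle_eqI[OF tree z] z(2) by simp
    have "g i c = 0" if "c \<notin> insert (\<epsilon> i) T" for c
    proof -
      have "a c = 0" using z(3) that unfolding chains_iff by blast
      then show ?thesis using that by (simp add: gz cell_chain_def)
    qed
    then show "supp (g i) \<subseteq> insert (\<epsilon> i) T" unfolding supp_def by blast
    have "a (\<epsilon> i) = 0" using z(3) \<epsilon>_T[OF i] unfolding chains_iff by blast
    then show "g i (\<epsilon> i) = 1" by (simp add: gz cell_chain_def)
  qed
  have g_\<epsilon>_other: "g i (\<epsilon> k) = 0" if "i \<in> ?I" "k \<in> ?I" "i \<noteq> k" for i k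
  proof -
    have "\<epsilon> k \<noteq> \<epsilon> i" using inj_on_eq_iff[OF inj] that by blast
    then have "\<epsilon> k \<notin> supp (g i)" using supp_g[OF that(1)] \<epsilon>_T[OF that(2)] by blast
    then show ?thesis unfolding supp_def by blast
  qed
  show ?thesis
    unfolding explicit_basis_iff[OF g]
  proof (intro conjI ballI)
    fix k assume k: "k \<in> ?I"
    have "\<epsilon> k \<in> supp (g k)" using g_\<epsilon>[OF k] by (simp add: supp_def)
    moreover have "\<epsilon> k \<notin> supp (g i)" if "i \<in> ?I - {k}" for i
      using g_\<epsilon>_other[of i k] that k by (simp add: supp_def)
    ultimately show "supp (g k) - (\<Union>i\<in>?I - {k}. supp (g i)) \<noteq> {}" by blast
  next
    fix z assume "z \<in> cycles K q \<inter> chains (\<Union>i\<in>?I. supp (g i))"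
    then have z: "z \<in> cycles K q" "z \<in> chains A" by (auto simp: A_def)
    \<comment> \<open>The values of \<open>z\<close> at the private cells are the only possible
      coefficients; what remains of \<open>z\<close> is a cycle on \<open>T\<close>.\<close>
    define d where "d = z + chain_comb (\<lambda>i. z (\<epsilon> i)) g ?I"
    have "chain_comb (\<lambda>i. z (\<epsilon> i)) g ?I \<in> cycles K q"
      by (rule chain_subspace_comb[OF chain_subspace_cycles]) (simp_all add: g_cyc)
    then have d: "d \<in> cycles K q"
      using z(1) chain_subspace_cycles[of q] by (simp add: d_def chain_subspace_def)
    have "d c = 0" if c: "c \<notin> T" for c
    proof (cases "c \<in> \<epsilon> ` ?I")
      case True
      then obtain k where k: "k \<in> ?I" "c = \<epsilon> k" by blast
      have "g i c = (if i = k then 1 else 0)" if "i \<in> ?I" for i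
      proof (cases "i = k")
        case True
        then show ?thesis using g_\<epsilon>[OF k(1)] k(2) by simp
      next
        case False
        then show ?thesis using g_\<epsilon>_other[OF that k(1) False] k(2) by simp
      qed
      then have "chain_comb (\<lambda>i. z (\<epsilon> i)) g ?I c = z (\<epsilon> k)"
        by (rule chain_comb_apply_delta[OF finite_atLeastAtMost k(1)])
      then show ?thesis unfolding d_def plus_fun_apply by (simp only: k(2) bit_add_self)
    next
      case False
      \<comment> \<open>Outside \<open>T\<close> and the private cells no \<open>g i\<close> has a
        cell, so \<open>c\<close> is not in \<open>A\<close> and \<open>z\<close> vanishes there as
        well.\<close>
      then have out: "g i c = 0" if "i \<in> ?I" for i
        using supp_g[OF that] c that unfolding supp_def by blast
      then have "c \<notin> A" unfolding A_def supp_def by auto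
      then have "z c = 0" using z(2) unfolding chains_iff by blast
      moreover have "chain_comb (\<lambda>i. z (\<epsilon> i)) g ?I c = 0"
        unfolding chain_comb_def using out by simp
      ultimately show ?thesis unfolding d_def plus_fun_apply by simp
    qed
    then have "d \<in> chains T" unfolding chains_iff by blast
    then have "d = 0" using tree d unfolding q_tree_iff by blast
    then have "z = chain_comb (\<lambda>i. z (\<epsilon> i)) g ?I"
      by (simp only: d_def chain_add_eq_0_iff)
    then show "\<exists>a. z = chain_comb a g ?I" by blast
  qed
qed

end

theorem theorem3:
  fixes K :: "'c cell_complex" and n q :: nat and g :: "nat \<Rightarrow> 'c chain"
  assumes "cell_complex n K"
    and "q \<le> n"
    and "homology_basis K q (betti K q) g"
  shows "explicit_basis K q (betti K q) g \<longleftrightarrow>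
    (\<exists>C T E. tri_partition K q C T E \<and>
      (\<exists>\<epsilon>. bij_betw \<epsilon> {1..betti K q} E \<and>
        (\<forall>i\<in>{1..betti K q}. induced_cycle K q T (\<epsilon> i) = g i)))"
proof -
  interpret finite_cell_complex n K by (rule finite_cell_complex.intro) (rule assms(1))
  show ?thesis
  proof
    assume "explicit_basis K q (betti K q) g"
    with assms(3) show "\<exists>C T E. tri_partition K q C T E \<and>
      (\<exists>\<epsilon>. bij_betw \<epsilon> {1..betti K q} E \<and>
        (\<forall>i\<in>{1..betti K q}. induced_cycle K q T (\<epsilon> i) = g i))"
      by (rule tri_partition_of_explicit)
  next
    assume "\<exists>C T E. tri_partition K q C T E \<and>
      (\<exists>\<epsilon>. bij_betw \<epsilon> {1..betti K q} E \<and>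
        (\<forall>i\<in>{1..betti K q}. induced_cycle K q T (\<epsilon> i) = g i))"
    then obtain C T E \<epsilon> where "tri_partition K q C T E" "bij_betw \<epsilon> {1..betti K q} E"
      "\<forall>i\<in>{1..betti K q}. induced_cycle K q T (\<epsilon> i) = g i"
      by blast
    then show "explicit_basis K q (betti K q) g"
      by (intro explicit_of_tri_partition[OF assms(3)]) blast+
  qed
qed

end
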